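(* Let $G=G^{str}\cup G^{def}$ be a defeasible graph and let $\langle p,\mathsf{sc},q\rangle$ be a defeasible triple. Then $G\models_{\min}\langle p,\mathsf{sc},q\rangle$ if and only if the procedure $\mathtt{DefMinEntailmentC}(G,\mathrm{r}(G),\langle p,\mathsf{sc},q\rangle)$ returns true, where $\mathrm{r}(G)$ is the output of $\mathtt{Ranking}(G)$.
   Context: **Syntax.** $U$ (URI references) and $L$ (literals, plain or typed) are disjoint sets; terms are the elements of $UL=U\cup L$. $\rho df_\bot=\{\mathsf{sp},\mathsf{sc},\mathsf{type},\mathsf{dom},\mathsf{range},\bot_c,\bot_p\}\subseteq U$. A ($\rho df_\bot$-)triple is $(s,p,o)\in UL\times U\times UL$ with $s,o\notin\rho df_\bot$; a graph is a finite set of triples; $\mathrm{uni}(G)$ is the set of terms occurring in it. A defeasible triple is $\langle s,p,o\rangle$ with $p\in\{\mathsf{sc},\mathsf{sp}\}$, $s,o\in UL\setminus\rho df_\bot$. A defeasible graph is $G=G^{str}\cup G^{def}$ with $G^{str}$ a graph and $G^{def}$ a finite set of defeasible triples. For a set $D$ of defeasible triples $D^s=\{(s,p,o):\langle s,p,o\rangle\in D\}$; $G^s=G^{str}\cup(G^{def})^s$. **Derivation.** Rules (metavariables range over $UL$): (2a) $(A,\mathsf{sp},B),(B,\mathsf{sp},C)\Rightarrow(A,\mathsf{sp},C)$; (2b) $(D,\mathsf{sp},E),(X,D,Y)\Rightarrow(X,E,Y)$; (3a) $(A,\mathsf{sc},B),(B,\mathsf{sc},C)\Rightarrow(A,\mathsf{sc},C)$;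 (3b) $(A,\mathsf{sc},B),(X,\mathsf{type},A)\Rightarrow(X,\mathsf{type},B)$; (4a) $(D,\mathsf{dom},B),(X,D,Y)\Rightarrow(X,\mathsf{type},B)$; (4b) $(D,\mathsf{range},B),(X,D,Y)\Rightarrow(Y,\mathsf{type},B)$; (5a) $(A,\bot_c,B)\Rightarrow(B,\bot_c,A)$; (5b) $(A,\bot_c,B),(C,\mathsf{sc},A)\Rightarrow(C,\bot_c,B)$; (5c) $(A,\bot_c,A)\Rightarrow(A,\bot_c,B)$; (6a) $(A,\bot_p,B)\Rightarrow(B,\bot_p,A)$; (6b) $(A,\bot_p,B),(C,\mathsf{sp},A)\Rightarrow(C,\bot_p,B)$; (6c) $(A,\bot_p,A)\Rightarrow(A,\bot_p,B)$; (7a) $(A,\mathsf{dom},C),(B,\mathsf{dom},D),(C,\bot_c,D)\Rightarrow(A,\bot_p,B)$; (7b) $(A,\mathsf{range},C),(B,\mathsf{range},D),(C,\bot_c,D)\Rightarrow(A,\bot_p,B)$. $\mathrm{Cl}(G)$ is the closure of $G$ under these rules; $G\vdash\tau$ means $\tau$ is derivable from $G$ by finitely many rule applications. **Interpretations.** An interpretation over $V\subseteq UL$ is $\mathcal I=\langle\Delta_R,\Delta_P,\Delta_C,\Delta_L,P[\cdot],C[\cdot],\cdot^{\mathcal I}\rangle$ with finite sets $\Delta_C\subseteq\Delta_R$, $L\cap V\subseteq\Delta_L\subseteq\Delta_R$, $\Delta_P$, maps $P:\Delta_P\to2^{\Delta_R\times\Delta_R}$, $C:\Delta_C\to2^{\Delta_R}$,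 and $\cdot^{\mathcal I}:UL\cap V\to\Delta_R\cup\Delta_P$, the identity on plain literals and mapping literals into $\Delta_R$. $\mathcal I\Vdash G$ iff $\mathcal I$ interprets (at least) $\rho df_\bot\cup\mathrm{uni}(G)$ and, writing $P_e=P[e^{\mathcal I}]$: for each $(s,p,o)\in G$, $p^{\mathcal I}\in\Delta_P$ and $(s^{\mathcal I},o^{\mathcal I})\in P[p^{\mathcal I}]$; $e^{\mathcal I}\in\Delta_P$ for $e\in\rho df_\bot$; $P_{\mathsf{sp}}$ is transitive over $\Delta_P$ and $(p,q)\in P_{\mathsf{sp}}$ implies $p,q\in\Delta_P$, $P[p]\subseteq P[q]$; $P_{\mathsf{sc}}$ is transitive over $\Delta_C$ and $(c,d)\in P_{\mathsf{sc}}$ implies $c,d\in\Delta_C$, $C[c]\subseteq C[d]$; $x\in C[c]$ iff $(x,c)\in P_{\mathsf{type}}$, and $(x,c)\in P_{\mathsf{type}}$ implies $c\in\Delta_C$; $(p,c)\in P_{\mathsf{dom}}$ (resp. $P_{\mathsf{range}}$) implies $p\in\Delta_P$, $c\in\Delta_C$ and, for all $(x,y)\in P[p]$, $x\in C[c]$ (resp. $y\in C[c]$); $P_{\bot_c}$ is a symmetric relation on $\Delta_C$ with: $(c,d)\in P_{\bot_c}$, $(e,c)\in P_{\mathsf{sc}}$ imply $(e,d)\in P_{\bot_c}$, and $(c,c)\in P_{\bot_c}$, $d\in\Delta_C$ imply $(c,d)\in P_{\bot_c}$; $P_{\bot_p}$ is a symmetric relation on $\Delta_P$ with the same two properties for $\mathsf{sp}$,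 $\Delta_P$; if $(p,c),(q,d)\in P_{\mathsf{dom}}$ (or both in $P_{\mathsf{range}}$) and $(c,d)\in P_{\bot_c}$ then $(p,q)\in P_{\bot_p}$. **Ranked models.** For a defeasible graph $G$ fix the domains $\Delta_R=\mathrm{uni}(G^s)\cup\rho df_\bot$; $\Delta_P=\rho df_\bot\cup\{p\in\mathrm{uni}(G^s):p$ is the predicate of a triple, the subject or object of an $\mathsf{sp}$- or $\bot_p$-triple, or the subject of a $\mathsf{dom}$- or $\mathsf{range}$-triple of $\mathrm{Cl}(G^s)\}$; $\Delta_C=\{c\in\mathrm{uni}(G^s):c$ is the object of a $\mathsf{type}$-, $\mathsf{dom}$- or $\mathsf{range}$-triple, or the subject or object of an $\mathsf{sc}$- or $\bot_c$-triple of $\mathrm{Cl}(G^s)\}$; $\Delta_L=\mathrm{uni}(G^s)\cap L$. Let $\mathcal M$ be the set of all interpretations over $\rho df_\bot\cup\mathrm{uni}(G^s)$ with these domains. A ranked interpretation is $\mathcal R=(\mathcal M,r)$ with $r:\mathcal M\to\mathbb N\cup\{\infty\}$ attaining $0$ and such that if $r$ attains $i\in\mathbb N$, $i>0$, it attains $i-1$. $\mathcal M_{\mathbb N}=\{\mathcal I:r(\mathcal I)<\infty\}$. $\mathrm{cmin}(t,\mathcal R)$ (resp. $\mathrm{pmin}(t,\mathcal R)$) is the set of $\mathcal I\in\mathcal M_{\mathbb N}$ of least rank among those in $\mathcal M_{\mathbb N}$ with $\mathcal I\not\Vdash(t,\bot_c,t)$ (resp. $\mathcal I\not\Vdash(t,\bot_p,t)$).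 $\mathcal R\Vdash(s,p,o)$ iff all $\mathcal I\in\mathcal M_{\mathbb N}$ satisfy it; $\mathcal R\Vdash\langle c,\mathsf{sc},d\rangle$ iff $\mathcal I\Vdash(c,\mathsf{sc},d)$ for all $\mathcal I\in\mathrm{cmin}(c,\mathcal R)$; $\mathcal R\Vdash\langle p,\mathsf{sp},q\rangle$ iff $\mathcal I\Vdash(p,\mathsf{sp},q)$ for all $\mathcal I\in\mathrm{pmin}(p,\mathcal R)$. $\mathcal R$ is a ranked model of $G$ if it satisfies every element of $G$. Put $(\mathcal M,r)\preceq(\mathcal M,r')$ iff $r\le r'$ pointwise; $G$ has a unique $\preceq$-minimal ranked model $\mathcal R_{\min G}$. $G\models_{\min}\tau$ iff $\mathcal R_{\min G}\Vdash\tau$. **Procedures.** $\mathtt{Ranking}(G)$: $D_0=G^{def}$; $D_{i+1}=\{\langle p,\mathsf{sc},q\rangle\in D_i:G^{str}\cup D_i^s\vdash(p,\bot_c,p)\}\cup\{\langle p,\mathsf{sp},q\rangle\in D_i:G^{str}\cup D_i^s\vdash(p,\bot_p,p)\}$; let $n$ be least with $D_n=D_{n+1}$, $D_\infty=D_n$; output $\mathrm{r}(G)=\{D_0,\dots,D_n,D_\infty\}$. $\mathtt{DefMinEntailmentC}(G,\mathrm{r}(G),\langle p,\mathsf{sc},q\rangle)$: set $D_{n+1}=D_\infty$. If $G^{str}\cup D_i^s\vdash(p,\bot_c,p)$ for all $0\le i\le n$, return true. Otherwise let $j\le n$ be least with $G^{str}\cup D_j^s\not\vdash(p,\bot_c,p)$,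 let $D^p$ be the set of all $\mathsf{sc}$-triples $\langle a,\mathsf{sc},b\rangle\in D_j\setminus D_{j+1}$, and return true iff $G^{str}\cup(D^p)^s\vdash(p,\mathsf{sc},q)$. *)

theory Defs
  imports "HOL-Library.Extended_Nat" "HOL-Library.FuncSet"
begin

section \<open>Syntax\<close>

text \<open>The first seven constructors are the reserved vocabulary, which belongs to the URI
  references.  Constructor distinctness gives the disjointness of \<open>U\<close> and \<open>L\<close>.\<close>

datatype ('u, 'a, 'b) rdf_term =
    Sp | Sc | Typ | Dom | Rng | Bot_c | Bot_p
  | Uri 'u
  | Plain 'a
  | Typed 'b

definition vocab :: "('u, 'a, 'b) rdf_term set" where
  "vocab = {Sp, Sc, Typ, Dom, Rng, Bot_c, Bot_p}"

definition plain_literals :: "('u, 'a, 'b) rdf_term set" where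
  "plain_literals = range Plain"

definition literals :: "('u, 'a, 'b) rdf_term set" where
  "literals = range Plain \<union> range Typed"

definition uris :: "('u, 'a, 'b) rdf_term set" where
  "uris = vocab \<union> range Uri"

text \<open>Predicates are not restricted to \<open>uris\<close> at the level of the type: the metavariables of the
  derivation rules range over all terms, so a literal occurring as the object of an \<open>Sp\<close>-triple
  may become the predicate of a derived triple.\<close>

type_synonym ('u, 'a, 'b) triple =
  "('u, 'a, 'b) rdf_term \<times> ('u, 'a, 'b) rdf_term \<times> ('u, 'a, 'b) rdf_term"

definition is_triple :: "('u, 'a, 'b) triple \<Rightarrow> bool" where
  "is_triple t \<longleftrightarrow> (case t of (s, p, ob) \<Rightarrow> p \<in> uris \<and> s \<notin> vocab \<and> ob \<notin> vocab)"

definition is_defeasible_triple :: "('u, 'a, 'b) triple \<Rightarrow> bool" where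
  "is_defeasible_triple t \<longleftrightarrow>
     (case t of (s, p, ob) \<Rightarrow> p \<in> {Sc, Sp} \<and> s \<notin> vocab \<and> ob \<notin> vocab)"

definition uni :: "('u, 'a, 'b) triple set \<Rightarrow> ('u, 'a, 'b) rdf_term set" where
  "uni T = (\<Union>(s, p, ob)\<in>T. {s, p, ob})"

datatype ('u, 'a, 'b) statement =
    Strict "('u, 'a, 'b) triple"
  | Defeasible "('u, 'a, 'b) triple"

type_synonym ('u, 'a, 'b) dgraph = "('u, 'a, 'b) statement set"

definition strict_part :: "('u, 'a, 'b) dgraph \<Rightarrow> ('u, 'a, 'b) triple set" where
  "strict_part G = {t. Strict t \<in> G}"

definition defeasible_part :: "('u, 'a, 'b) dgraph \<Rightarrow> ('u, 'a, 'b) statement set" where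
  "defeasible_part G = {\<tau> \<in> G. \<exists>t. \<tau> = Defeasible t}"

definition defeasible_graph :: "('u, 'a, 'b) dgraph \<Rightarrow> bool" where
  "defeasible_graph G \<longleftrightarrow>
     finite G \<and>
     (\<forall>t. Strict t \<in> G \<longrightarrow> is_triple t) \<and>
     (\<forall>t. Defeasible t \<in> G \<longrightarrow> is_defeasible_triple t)"

text \<open>\<open>strictify D\<close> is \<open>D\<close> with superscript s, and \<open>strict_counterpart G\<close> is \<open>G\<close> with
  superscript s.\<close>

definition strictify :: "('u, 'a, 'b) statement set \<Rightarrow> ('u, 'a, 'b) triple set" where
  "strictify D = {t. Defeasible t \<in> D}"

definition strict_counterpart :: "('u, 'a, 'b) dgraph \<Rightarrow> ('u, 'a, 'b) triple set" where
  "strict_counterpart G = strict_part G \<union> strictify (defeasible_part G)"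

section \<open>Derivation\<close>

inductive_set Cl :: "('u, 'a, 'b) triple set \<Rightarrow> ('u, 'a, 'b) triple set"
  for T :: "('u, 'a, 'b) triple set"
where
  base: "t \<in> T \<Longrightarrow> t \<in> Cl T"
| r2a: "(A, Sp, B) \<in> Cl T \<Longrightarrow> (B, Sp, C) \<in> Cl T \<Longrightarrow> (A, Sp, C) \<in> Cl T"
| r2b: "(D, Sp, E) \<in> Cl T \<Longrightarrow> (X, D, Y) \<in> Cl T \<Longrightarrow> (X, E, Y) \<in> Cl T"
| r3a: "(A, Sc, B) \<in> Cl T \<Longrightarrow> (B, Sc, C) \<in> Cl T \<Longrightarrow> (A, Sc, C) \<in> Cl T"
| r3b: "(A, Sc, B) \<in> Cl T \<Longrightarrow> (X, Typ, A) \<in> Cl T \<Longrightarrow> (X, Typ, B) \<in> Cl T"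
| r4a: "(D, Dom, B) \<in> Cl T \<Longrightarrow> (X, D, Y) \<in> Cl T \<Longrightarrow> (X, Typ, B) \<in> Cl T"
| r4b: "(D, Rng, B) \<in> Cl T \<Longrightarrow> (X, D, Y) \<in> Cl T \<Longrightarrow> (Y, Typ, B) \<in> Cl T"
| r5a: "(A, Bot_c, B) \<in> Cl T \<Longrightarrow> (B, Bot_c, A) \<in> Cl T"
| r5b: "(A, Bot_c, B) \<in> Cl T \<Longrightarrow> (C, Sc, A) \<in> Cl T \<Longrightarrow> (C, Bot_c, B) \<in> Cl T"
| r5c: "(A, Bot_c, A) \<in> Cl T \<Longrightarrow> (A, Bot_c, B) \<in> Cl T"
| r6a: "(A, Bot_p, B) \<in> Cl T \<Longrightarrow> (B, Bot_p, A) \<in> Cl T"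
| r6b: "(A, Bot_p, B) \<in> Cl T \<Longrightarrow> (C, Sp, A) \<in> Cl T \<Longrightarrow> (C, Bot_p, B) \<in> Cl T"
| r6c: "(A, Bot_p, A) \<in> Cl T \<Longrightarrow> (A, Bot_p, B) \<in> Cl T"
| r7a: "(A, Dom, C) \<in> Cl T \<Longrightarrow> (B, Dom, D) \<in> Cl T \<Longrightarrow> (C, Bot_c, D) \<in> Cl T
        \<Longrightarrow> (A, Bot_p, B) \<in> Cl T"
| r7b: "(A, Rng, C) \<in> Cl T \<Longrightarrow> (B, Rng, D) \<in> Cl T \<Longrightarrow> (C, Bot_c, D) \<in> Cl T
        \<Longrightarrow> (A, Bot_p, B) \<in> Cl T"

abbreviation derives :: "('u, 'a, 'b) triple set \<Rightarrow> ('u, 'a, 'b) triple \<Rightarrow> bool"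
  (infix "\<turnstile>" 50) where
  "T \<turnstile> t \<equiv> t \<in> Cl T"

section \<open>Interpretations\<close>

text \<open>Resources are taken to be terms, as is the case for the domains fixed below for ranked
  interpretations.  The field \<open>voc\<close> is the set of interpreted terms.  All maps are required to be
  extensional, so that equality of records is equality of interpretations; otherwise a ranking
  could separate two copies of the same interpretation.\<close>

record ('u, 'a, 'b) interp =
  voc :: "('u, 'a, 'b) rdf_term set"
  dR :: "('u, 'a, 'b) rdf_term set"
  dP :: "('u, 'a, 'b) rdf_term set"
  dC :: "('u, 'a, 'b) rdf_term set"
  dL :: "('u, 'a, 'b) rdf_term set"
  Pext :: "('u, 'a, 'b) rdf_term \<Rightarrow> (('u, 'a, 'b) rdf_term \<times> ('u, 'a, 'b) rdf_term) set"
  Cext :: "('u, 'a, 'b) rdf_term \<Rightarrow> ('u, 'a, 'b) rdf_term set"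
  den :: "('u, 'a, 'b) rdf_term \<Rightarrow> ('u, 'a, 'b) rdf_term"

definition is_interp :: "('u, 'a, 'b) interp \<Rightarrow> bool" where
  "is_interp I \<longleftrightarrow>
     finite (dR I) \<and> finite (dP I) \<and> finite (dC I) \<and> finite (dL I) \<and>
     dC I \<subseteq> dR I \<and> literals \<inter> voc I \<subseteq> dL I \<and> dL I \<subseteq> dR I \<and>
     Pext I \<in> dP I \<rightarrow>\<^sub>E Pow (dR I \<times> dR I) \<and>
     Cext I \<in> dC I \<rightarrow>\<^sub>E Pow (dR I) \<and>
     den I \<in> voc I \<rightarrow>\<^sub>E dR I \<union> dP I \<and>
     (\<forall>l \<in> plain_literals \<inter> voc I. den I l = l) \<and>
     (\<forall>l \<in> literals \<inter> voc I. den I l \<in> dR I)"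

abbreviation Pden ::
  "('u, 'a, 'b) interp \<Rightarrow> ('u, 'a, 'b) rdf_term
    \<Rightarrow> (('u, 'a, 'b) rdf_term \<times> ('u, 'a, 'b) rdf_term) set" where
  "Pden I e \<equiv> Pext I (den I e)"

definition sat_simple :: "('u, 'a, 'b) interp \<Rightarrow> ('u, 'a, 'b) triple set \<Rightarrow> bool" where
  "sat_simple I T \<longleftrightarrow>
     (\<forall>(s, p, ob) \<in> T. den I p \<in> dP I \<and> (den I s, den I ob) \<in> Pden I p) \<and>
     (\<forall>e \<in> vocab. den I e \<in> dP I)"

definition sat_subproperty :: "('u, 'a, 'b) interp \<Rightarrow> bool" where
  "sat_subproperty I \<longleftrightarrow>
     trans_on (dP I) (Pden I Sp) \<and>
     (\<forall>(p, q) \<in> Pden I Sp. p \<in> dP I \<and> q \<in> dP I \<and> Pext I p \<subseteq> Pext I q)"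

definition sat_subclass :: "('u, 'a, 'b) interp \<Rightarrow> bool" where
  "sat_subclass I \<longleftrightarrow>
     trans_on (dC I) (Pden I Sc) \<and>
     (\<forall>(c, d) \<in> Pden I Sc. c \<in> dC I \<and> d \<in> dC I \<and> Cext I c \<subseteq> Cext I d)"

definition sat_typing :: "('u, 'a, 'b) interp \<Rightarrow> bool" where
  "sat_typing I \<longleftrightarrow>
     (\<forall>c \<in> dC I. \<forall>x. x \<in> Cext I c \<longleftrightarrow> (x, c) \<in> Pden I Typ) \<and>
     (\<forall>(x, c) \<in> Pden I Typ. c \<in> dC I) \<and>
     (\<forall>(p, c) \<in> Pden I Dom. p \<in> dP I \<and> c \<in> dC I \<and> (\<forall>(x, y) \<in> Pext I p. x \<in> Cext I c)) \<and>
     (\<forall>(p, c) \<in> Pden I Rng. p \<in> dP I \<and> c \<in> dC I \<and> (\<forall>(x, y) \<in> Pext I p. y \<in> Cext I c))"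

definition sat_disjointness :: "('u, 'a, 'b) interp \<Rightarrow> bool" where
  "sat_disjointness I \<longleftrightarrow>
     Pden I Bot_c \<subseteq> dC I \<times> dC I \<and> sym (Pden I Bot_c) \<and>
     (\<forall>c d e. (c, d) \<in> Pden I Bot_c \<longrightarrow> (e, c) \<in> Pden I Sc \<longrightarrow> (e, d) \<in> Pden I Bot_c) \<and>
     (\<forall>c d. (c, c) \<in> Pden I Bot_c \<longrightarrow> d \<in> dC I \<longrightarrow> (c, d) \<in> Pden I Bot_c) \<and>
     Pden I Bot_p \<subseteq> dP I \<times> dP I \<and> sym (Pden I Bot_p) \<and>
     (\<forall>p q e. (p, q) \<in> Pden I Bot_p \<longrightarrow> (e, p) \<in> Pden I Sp \<longrightarrow> (e, q) \<in> Pden I Bot_p) \<and>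
     (\<forall>p q. (p, p) \<in> Pden I Bot_p \<longrightarrow> q \<in> dP I \<longrightarrow> (p, q) \<in> Pden I Bot_p) \<and>
     (\<forall>p q c d. (p, c) \<in> Pden I Dom \<longrightarrow> (q, d) \<in> Pden I Dom \<longrightarrow> (c, d) \<in> Pden I Bot_c
        \<longrightarrow> (p, q) \<in> Pden I Bot_p) \<and>
     (\<forall>p q c d. (p, c) \<in> Pden I Rng \<longrightarrow> (q, d) \<in> Pden I Rng \<longrightarrow> (c, d) \<in> Pden I Bot_c
        \<longrightarrow> (p, q) \<in> Pden I Bot_p)"

definition sat :: "('u, 'a, 'b) interp \<Rightarrow> ('u, 'a, 'b) triple set \<Rightarrow> bool" where
  "sat I T \<longleftrightarrow>
     vocab \<union> uni T \<subseteq> voc I \<and>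
     sat_simple I T \<and> sat_subproperty I \<and> sat_subclass I \<and> sat_typing I \<and> sat_disjointness I"

abbreviation sat_triple :: "('u, 'a, 'b) interp \<Rightarrow> ('u, 'a, 'b) triple \<Rightarrow> bool" where
  "sat_triple I t \<equiv> sat I {t}"

section \<open>Ranked models\<close>

definition DomR :: "('u, 'a, 'b) dgraph \<Rightarrow> ('u, 'a, 'b) rdf_term set" where
  "DomR G = uni (strict_counterpart G) \<union> vocab"

definition DomP :: "('u, 'a, 'b) dgraph \<Rightarrow> ('u, 'a, 'b) rdf_term set" where
  "DomP G = (let K = Cl (strict_counterpart G) in
     vocab \<union> {p \<in> uni (strict_counterpart G).
       \<exists>x y. (x, p, y) \<in> K
           \<or> (p, Sp, y) \<in> K \<or> (x, Sp, p) \<in> K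
           \<or> (p, Bot_p, y) \<in> K \<or> (x, Bot_p, p) \<in> K
           \<or> (p, Dom, y) \<in> K \<or> (p, Rng, y) \<in> K})"

definition DomC :: "('u, 'a, 'b) dgraph \<Rightarrow> ('u, 'a, 'b) rdf_term set" where
  "DomC G = (let K = Cl (strict_counterpart G) in
     {c \<in> uni (strict_counterpart G).
       \<exists>x. (x, Typ, c) \<in> K \<or> (x, Dom, c) \<in> K \<or> (x, Rng, c) \<in> K
         \<or> (c, Sc, x) \<in> K \<or> (x, Sc, c) \<in> K
         \<or> (c, Bot_c, x) \<in> K \<or> (x, Bot_c, c) \<in> K})"

definition DomL :: "('u, 'a, 'b) dgraph \<Rightarrow> ('u, 'a, 'b) rdf_term set" where
  "DomL G = uni (strict_counterpart G) \<inter> literals"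

definition interps :: "('u, 'a, 'b) dgraph \<Rightarrow> ('u, 'a, 'b) interp set" where
  "interps G = {I. is_interp I \<and> voc I = vocab \<union> uni (strict_counterpart G) \<and>
     dR I = DomR G \<and> dP I = DomP G \<and> dC I = DomC G \<and> dL I = DomL G}"

text \<open>A ranked interpretation \<open>(\<M>, r)\<close> is represented by its ranking \<open>r\<close>, a function with domain
  \<open>interps G\<close>.\<close>

type_synonym ('u, 'a, 'b) ranking = "('u, 'a, 'b) interp \<Rightarrow> enat"

definition ranked_interp :: "('u, 'a, 'b) dgraph \<Rightarrow> ('u, 'a, 'b) ranking \<Rightarrow> bool" where
  "ranked_interp G r \<longleftrightarrow>
     r \<in> interps G \<rightarrow>\<^sub>E UNIV \<and>
     0 \<in> r ` interps G \<and>
     (\<forall>i::nat. i > 0 \<longrightarrow> enat i \<in> r ` interps G \<longrightarrow> enat (i - 1) \<in> r ` interps G)"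

definition finite_rank ::
  "('u, 'a, 'b) dgraph \<Rightarrow> ('u, 'a, 'b) ranking \<Rightarrow> ('u, 'a, 'b) interp set" where
  "finite_rank G r = {I \<in> interps G. r I < \<infinity>}"

definition cmin ::
  "('u, 'a, 'b) rdf_term \<Rightarrow> ('u, 'a, 'b) dgraph \<Rightarrow> ('u, 'a, 'b) ranking
    \<Rightarrow> ('u, 'a, 'b) interp set" where
  "cmin t G r = {I \<in> finite_rank G r. \<not> sat_triple I (t, Bot_c, t) \<and>
     (\<forall>J \<in> finite_rank G r. \<not> sat_triple J (t, Bot_c, t) \<longrightarrow> r I \<le> r J)}"

definition pmin ::
  "('u, 'a, 'b) rdf_term \<Rightarrow> ('u, 'a, 'b) dgraph \<Rightarrow> ('u, 'a, 'b) ranking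
    \<Rightarrow> ('u, 'a, 'b) interp set" where
  "pmin t G r = {I \<in> finite_rank G r. \<not> sat_triple I (t, Bot_p, t) \<and>
     (\<forall>J \<in> finite_rank G r. \<not> sat_triple J (t, Bot_p, t) \<longrightarrow> r I \<le> r J)}"

definition ranked_sat ::
  "('u, 'a, 'b) dgraph \<Rightarrow> ('u, 'a, 'b) ranking \<Rightarrow> ('u, 'a, 'b) statement \<Rightarrow> bool" where
  "ranked_sat G r \<tau> \<longleftrightarrow> (case \<tau> of
       Strict t \<Rightarrow> \<forall>I \<in> finite_rank G r. sat_triple I t
     | Defeasible (s, p, ob) \<Rightarrow>
         (p = Sc \<and> (\<forall>I \<in> cmin s G r. sat_triple I (s, Sc, ob))) \<or>
         (p = Sp \<and> (\<forall>I \<in> pmin s G r. sat_triple I (s, Sp, ob))))"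

definition ranked_model :: "('u, 'a, 'b) dgraph \<Rightarrow> ('u, 'a, 'b) ranking \<Rightarrow> bool" where
  "ranked_model G r \<longleftrightarrow> ranked_interp G r \<and> (\<forall>\<tau> \<in> G. ranked_sat G r \<tau>)"

definition rank_le ::
  "('u, 'a, 'b) dgraph \<Rightarrow> ('u, 'a, 'b) ranking \<Rightarrow> ('u, 'a, 'b) ranking \<Rightarrow> bool" where
  "rank_le G r r' \<longleftrightarrow> (\<forall>I \<in> interps G. r I \<le> r' I)"

definition minimal_ranked_model ::
  "('u, 'a, 'b) dgraph \<Rightarrow> ('u, 'a, 'b) ranking \<Rightarrow> bool" where
  "minimal_ranked_model G r \<longleftrightarrow>
     ranked_model G r \<and> (\<forall>r'. ranked_model G r' \<longrightarrow> rank_le G r' r \<longrightarrow> r' = r)"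

definition R_min :: "('u, 'a, 'b) dgraph \<Rightarrow> ('u, 'a, 'b) ranking" where
  "R_min G = (THE r. minimal_ranked_model G r)"

definition min_entails ::
  "('u, 'a, 'b) dgraph \<Rightarrow> ('u, 'a, 'b) statement \<Rightarrow> bool"
  (infix "\<Turnstile>\<^sub>m\<^sub>i\<^sub>n" 50) where
  "G \<Turnstile>\<^sub>m\<^sub>i\<^sub>n \<tau> \<longleftrightarrow> ranked_sat G (R_min G) \<tau>"

section \<open>Procedures\<close>

primrec D_seq :: "('u, 'a, 'b) dgraph \<Rightarrow> nat \<Rightarrow> ('u, 'a, 'b) statement set" where
  "D_seq G 0 = defeasible_part G"
| "D_seq G (Suc i) =
     {Defeasible (p, Sc, q) | p q. Defeasible (p, Sc, q) \<in> D_seq G i \<and>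
        strict_part G \<union> strictify (D_seq G i) \<turnstile> (p, Bot_c, p)} \<union>
     {Defeasible (p, Sp, q) | p q. Defeasible (p, Sp, q) \<in> D_seq G i \<and>
        strict_part G \<union> strictify (D_seq G i) \<turnstile> (p, Bot_p, p)}"

text \<open>The output is the list of length \<open>n + 2\<close> with entries \<open>D\<^sub>0, \<dots>, D\<^sub>n, D\<^sub>\<infinity>\<close>.\<close>

definition Ranking :: "('u, 'a, 'b) dgraph \<Rightarrow> ('u, 'a, 'b) statement set list" where
  "Ranking G = (let n = (LEAST n. D_seq G n = D_seq G (Suc n)) in
     map (D_seq G) [0..<Suc n] @ [D_seq G n])"

text \<open>\<open>DefMinEntailmentC G rs p q\<close> is the value returned for the query with subject \<open>p\<close>,
  predicate \<open>Sc\<close> and object \<open>q\<close>.  The entry of \<open>rs\<close> at index \<open>n + 1\<close> is the last one, so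
  \<open>rs ! (n + 1)\<close> is \<open>D\<^sub>\<infinity>\<close>.\<close>

definition DefMinEntailmentC ::
  "('u, 'a, 'b) dgraph \<Rightarrow> ('u, 'a, 'b) statement set list
    \<Rightarrow> ('u, 'a, 'b) rdf_term \<Rightarrow> ('u, 'a, 'b) rdf_term \<Rightarrow> bool" where
  "DefMinEntailmentC G rs p q \<longleftrightarrow>
     (let n = length rs - 2;
          exceptional = (\<lambda>i. strict_part G \<union> strictify (rs ! i) \<turnstile> (p, Bot_c, p))
      in if \<forall>i\<le>n. exceptional i then True
         else let j = (LEAST j. j \<le> n \<and> \<not> exceptional j);
                  Dp = {Defeasible (a, Sc, b) | a b.
                          Defeasible (a, Sc, b) \<in> rs ! j - rs ! (j + 1)}
              in strict_part G \<union> strictify Dp \<turnstile> (p, Sc, q))"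

end

theory Submission
  imports Defs
begin

text \<open>
  Say that an interpretation complies with a default with subject \<open>s\<close> if it satisfies the strict
  version of the default or makes \<open>s\<close> disjoint from itself.  Derivation from the strict part
  together with \<open>D\<^sub>i\<close> is sound for the interpretations that satisfy the strict part and
  merely comply with \<open>D\<^sub>i\<close>, up to terms that are disjoint from themselves, and
  the term model of the closure shows that it is complete.  The minimal ranked model therefore gives
  each interpretation the least \<open>i\<close> such that it complies with \<open>D\<^sub>i\<close>.  If \<open>j\<close> is the least
  index at which \<open>p\<close> is not exceptional, the minimal interpretations for \<open>p\<close> have rank \<open>j\<close>, and
  the term model at level \<open>j\<close> is one of them.  Defaults in \<open>D\<^sub>j\<^sub>+\<^sub>1\<close> cannot
  contribute to a derivation of \<open>(p, Sc, q)\<close> at level \<open>j\<close>, as their subjects are exceptional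
  there and \<open>p\<close> would be as well.
\<close>

section \<open>Derivation\<close>

definition vocab_free :: "('u, 'a, 'b) triple set \<Rightarrow> bool" where
  "vocab_free T \<longleftrightarrow> (\<forall>(s, p, ob) \<in> T. s \<notin> vocab \<and> ob \<notin> vocab)"

lemma Cl_mono: "T \<subseteq> T' \<Longrightarrow> Cl T \<subseteq> Cl T'"
proof
  fix t assume "t \<in> Cl T" and "T \<subseteq> T'"
  then show "t \<in> Cl T'"
    by (induction rule: Cl.induct) (blast intro: Cl.intros)+
qed

text \<open>Rules 5c and 6c put arbitrary terms into disjointness triples, hence the exclusion.\<close>

lemma Cl_terms:
  assumes "(s, p, ob) \<in> Cl T" and "vocab_free T" and "p \<noteq> Bot_c" and "p \<noteq> Bot_p"
  shows "s \<in> uni T - vocab \<and> ob \<in> uni T - vocab"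
  using assms(1,3,4)
proof (induction "(s, p, ob)" arbitrary: s p ob rule: Cl.induct)
  case base
  then show ?case using assms(2) by (force simp: vocab_free_def uni_def)
next
  \<comment> \<open>The hypothesis for \<open>(D, Sp, E)\<close> puts \<open>D\<close> outside
    \<open>vocab\<close>; hence \<open>D\<close> is not a disjointness predicate and the hypothesis
    for \<open>(X, D, Y)\<close> applies.\<close>
  case (r2b D E X Y)
  then show ?case by (auto simp: vocab_def)
next
  case (r4a D B X Y)
  then show ?case by (auto simp: vocab_def)
next
  case (r4b D B X Y)
  then show ?case by (auto simp: vocab_def)
qed auto

text \<open>Consequently rule 2b never produces a triple with a reserved predicate, which disposes
  of that rule in later inductions.\<close>

lemma Cl_sp_object_not_vocab:
  assumes "(D, Sp, E) \<in> Cl T" and "vocab_free T"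
  shows "E \<notin> vocab"
  using Cl_terms[OF assms] by simp

text \<open>Rule 5b replaces one side of \<open>(b, Bot_c, b)\<close> by \<open>a\<close>; after a
  swap by 5a it replaces the other.\<close>

lemma Cl_bot_c_below:
  assumes "(a, Sc, b) \<in> Cl T" and "(b, Bot_c, b) \<in> Cl T"
  shows "(a, Bot_c, a) \<in> Cl T"
  using assms by (meson Cl.r5a Cl.r5b)

section \<open>Satisfaction\<close>

lemma sat_triple_iff:
  "sat_triple I (s, p, ob) \<longleftrightarrow>
     sat I {} \<and> s \<in> voc I \<and> p \<in> voc I \<and> ob \<in> voc I \<and> den I p \<in> dP I \<and>
     (den I s, den I ob) \<in> Pden I p"
  by (auto simp: sat_def sat_simple_def uni_def)

lemma sat_mono:
  assumes "sat I T" and "T' \<subseteq> T" shows "sat I T'"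
proof -
  have "uni T' \<subseteq> uni T" using assms(2) by (auto simp: uni_def)
  moreover have "sat_simple I T'"
    using assms unfolding sat_def sat_simple_def by blast
  ultimately show ?thesis using assms(1) unfolding sat_def by blast
qed

lemma sat_vocab:
  assumes "sat I {}" and "e \<in> vocab"
  shows "e \<in> voc I" and "den I e \<in> dP I"
  using assms by (auto simp: sat_def sat_simple_def)

lemma vocab_members [simp]:
  "Sp \<in> vocab" "Sc \<in> vocab" "Typ \<in> vocab" "Dom \<in> vocab" "Rng \<in> vocab"
  "Bot_c \<in> vocab" "Bot_p \<in> vocab"
  by (auto simp: vocab_def)

section \<open>Semantic counterparts of the derivation rules\<close>

lemma sat_sp_trans:
  assumes "sat_triple I (a, Sp, b)" and "sat_triple I (b, Sp, c)"
  shows "sat_triple I (a, Sp, c)"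
proof -
  from assms have "sat_subproperty I" by (simp add: sat_def)
  then have tr: "trans_on (dP I) (Pden I Sp)"
    and "\<And>x y. (x, y) \<in> Pden I Sp \<Longrightarrow> x \<in> dP I \<and> y \<in> dP I"
    by (auto simp: sat_subproperty_def)
  with assms have "(den I a, den I c) \<in> Pden I Sp"
    unfolding sat_triple_iff by (meson trans_onD)
  with assms show ?thesis by (simp add: sat_triple_iff)
qed

lemma sat_sc_trans:
  assumes "sat_triple I (a, Sc, b)" and "sat_triple I (b, Sc, c)"
  shows "sat_triple I (a, Sc, c)"
proof -
  from assms have "sat_subclass I" by (simp add: sat_def)
  then have tr: "trans_on (dC I) (Pden I Sc)"
    and "\<And>x y. (x, y) \<in> Pden I Sc \<Longrightarrow> x \<in> dC I \<and> y \<in> dC I"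
    by (auto simp: sat_subclass_def)
  with assms have "(den I a, den I c) \<in> Pden I Sc"
    unfolding sat_triple_iff by (meson trans_onD)
  with assms show ?thesis by (simp add: sat_triple_iff)
qed

lemma sat_bot_c_sym:
  assumes "sat_triple I (a, Bot_c, b)" shows "sat_triple I (b, Bot_c, a)"
proof -
  from assms have "sat_disjointness I" by (simp add: sat_def)
  then have "sym (Pden I Bot_c)" unfolding sat_disjointness_def by (elim conjE)
  with assms show ?thesis by (auto simp: sat_triple_iff dest: symD)
qed

lemma sat_bot_p_sym:
  assumes "sat_triple I (a, Bot_p, b)" shows "sat_triple I (b, Bot_p, a)"
proof -
  from assms have "sat_disjointness I" by (simp add: sat_def)
  then have "sym (Pden I Bot_p)" unfolding sat_disjointness_def by (elim conjE)
  with assms show ?thesis by (auto simp: sat_triple_iff dest: symD)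
qed

lemma sat_bot_c_down:
  assumes "sat_triple I (a, Bot_c, b)" and "sat_triple I (c, Sc, a)"
  shows "sat_triple I (c, Bot_c, b)"
proof -
  from assms have "sat_disjointness I" by (simp add: sat_def)
  then have "\<forall>c d e. (c, d) \<in> Pden I Bot_c \<longrightarrow> (e, c) \<in> Pden I Sc \<longrightarrow> (e, d) \<in> Pden I Bot_c"
    unfolding sat_disjointness_def by (elim conjE)
  moreover have "(den I a, den I b) \<in> Pden I Bot_c" "(den I c, den I a) \<in> Pden I Sc"
    using assms by (simp_all add: sat_triple_iff)
  ultimately have "(den I c, den I b) \<in> Pden I Bot_c" by blast
  with assms show ?thesis by (simp add: sat_triple_iff)
qed

lemma sat_bot_p_down:
  assumes "sat_triple I (a, Bot_p, b)" and "sat_triple I (c, Sp, a)"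
  shows "sat_triple I (c, Bot_p, b)"
proof -
  from assms have "sat_disjointness I" by (simp add: sat_def)
  then have "\<forall>p q e. (p, q) \<in> Pden I Bot_p \<longrightarrow> (e, p) \<in> Pden I Sp \<longrightarrow> (e, q) \<in> Pden I Bot_p"
    unfolding sat_disjointness_def by (elim conjE)
  moreover have "(den I a, den I b) \<in> Pden I Bot_p" "(den I c, den I a) \<in> Pden I Sp"
    using assms by (simp_all add: sat_triple_iff)
  ultimately have "(den I c, den I b) \<in> Pden I Bot_p" by blast
  with assms show ?thesis by (simp add: sat_triple_iff)
qed

lemma sat_bot_c_below:
  assumes "sat_triple I (a, Sc, b)" and "sat_triple I (b, Bot_c, b)"
  shows "sat_triple I (a, Bot_c, a)"
  using assms by (meson sat_bot_c_down sat_bot_c_sym)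

lemma sat_bot_p_below:
  assumes "sat_triple I (a, Sp, b)" and "sat_triple I (b, Bot_p, b)"
  shows "sat_triple I (a, Bot_p, a)"
  using assms by (meson sat_bot_p_down sat_bot_p_sym)

text \<open>The conclusion of rule 5c holds in an interpretation only if the new term denotes a class.\<close>

lemma sat_bot_c_class:
  assumes "sat_triple I (a, Bot_c, a)" and "b \<in> voc I" and "den I b \<in> dC I"
  shows "sat_triple I (a, Bot_c, b)"
proof -
  from assms have "sat_disjointness I" by (simp add: sat_def)
  then have "\<forall>c d. (c, c) \<in> Pden I Bot_c \<longrightarrow> d \<in> dC I \<longrightarrow> (c, d) \<in> Pden I Bot_c"
    unfolding sat_disjointness_def by (elim conjE)
  moreover have "(den I a, den I a) \<in> Pden I Bot_c"
    using assms by (simp_all add: sat_triple_iff)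
  ultimately have "(den I a, den I b) \<in> Pden I Bot_c" using assms(3) by blast
  with assms show ?thesis by (simp add: sat_triple_iff)
qed

text \<open>Provides the class premise of \<open>sat_bot_c_class\<close> when soundness reaches
  rules 7a and 7b.\<close>

lemma sat_dom_range_class:
  assumes "sat_triple I (a, p, c)" and "p \<in> {Dom, Rng}"
  shows "c \<in> voc I" and "den I c \<in> dC I"
proof -
  from assms have "sat_typing I" by (simp add: sat_def)
  with assms show "c \<in> voc I" and "den I c \<in> dC I"
    by (auto simp: sat_triple_iff sat_typing_def)
qed

lemma sat_bot_p_intro:
  assumes "sat_triple I (a, p, c)" and "sat_triple I (b, p, d)" and "p \<in> {Dom, Rng}"
    and "sat_triple I (c, Bot_c, d)"
  shows "sat_triple I (a, Bot_p, b)"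
proof -
  from assms have "sat_disjointness I" by (simp add: sat_def)
  then have
    "\<forall>p q c d. (p, c) \<in> Pden I Dom \<longrightarrow> (q, d) \<in> Pden I Dom \<longrightarrow> (c, d) \<in> Pden I Bot_c
        \<longrightarrow> (p, q) \<in> Pden I Bot_p"
    "\<forall>p q c d. (p, c) \<in> Pden I Rng \<longrightarrow> (q, d) \<in> Pden I Rng \<longrightarrow> (c, d) \<in> Pden I Bot_c
        \<longrightarrow> (p, q) \<in> Pden I Bot_p"
    unfolding sat_disjointness_def by - (elim conjE, assumption)+
  moreover have "(den I a, den I c) \<in> Pden I p" "(den I b, den I d) \<in> Pden I p"
    "(den I c, den I d) \<in> Pden I Bot_c"
    using assms by (simp_all add: sat_triple_iff)
  ultimately have "(den I a, den I b) \<in> Pden I Bot_p"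
    using assms(3) by (elim insertE emptyE; hypsubst; blast)
  with assms show ?thesis
    using sat_vocab[of I Bot_p] by (simp add: sat_triple_iff)
qed

section \<open>Soundness for compliance\<close>

text \<open>The predicate that marks the subject of a default as exceptional; it lets class and
  property defaults share one argument.\<close>

definition disj_pred :: "('u, 'a, 'b) rdf_term \<Rightarrow> ('u, 'a, 'b) rdf_term" where
  "disj_pred p = (if p = Sc then Bot_c else Bot_p)"

lemma disj_pred_simps [simp]: "disj_pred Sc = Bot_c" "disj_pred Sp = Bot_p"
  by (simp_all add: disj_pred_def)

definition complies :: "('u, 'a, 'b) interp \<Rightarrow> ('u, 'a, 'b) statement set \<Rightarrow> bool" where
  "complies I D \<longleftrightarrow>
     (\<forall>s p ob. Defeasible (s, p, ob) \<in> D \<longrightarrow>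
        sat_triple I (s, disj_pred p, s) \<or> sat_triple I (s, p, ob))"

lemma complies_mono: "complies I D \<Longrightarrow> D' \<subseteq> D \<Longrightarrow> complies I D'"
  by (auto simp: complies_def)

definition default_set :: "('u, 'a, 'b) statement set \<Rightarrow> bool" where
  "default_set D \<longleftrightarrow> (\<forall>t. Defeasible t \<in> D \<longrightarrow> is_defeasible_triple t)"

lemma vocab_free_union:
  assumes "\<forall>t\<in>S. is_triple t" and "default_set D"
  shows "vocab_free (S \<union> strictify D)"
  using assms
  by (fastforce simp: vocab_free_def is_triple_def default_set_def is_defeasible_triple_def
      strictify_def)

text \<open>Derivable triples whose predicate is \<open>Typ\<close> or not reserved may fail, since a property that
  is disjoint from itself may have a nonempty extension; no rule leads from them to the triples
  treated here.\<close>

lemma complies_sound: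
  assumes "(s, p, ob) \<in> Cl (S \<union> strictify D)"
    and S: "\<forall>t\<in>S. sat_triple I t" and D: "complies I D"
    and S_triples: "\<forall>t\<in>S. is_triple t" and D_triples: "default_set D"
  shows
    "(p \<in> {Sc, Sp} \<longrightarrow> sat_triple I (s, disj_pred p, s) \<or> sat_triple I (s, p, ob)) \<and>
     (p \<in> {Bot_c, Bot_p} \<longrightarrow>
        sat_triple I (s, p, ob) \<or> sat_triple I (s, p, s) \<or> sat_triple I (ob, p, ob)) \<and>
     (p \<in> {Dom, Rng} \<longrightarrow> sat_triple I (s, p, ob))"
  using assms(1)
proof (induction "(s, p, ob)" arbitrary: s p ob rule: Cl.induct)
  case (base s p ob)
  then consider "(s, p, ob) \<in> S" | "Defeasible (s, p, ob) \<in> D" "p \<in> {Sc, Sp}"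
    using D_triples by (auto simp: strictify_def default_set_def is_defeasible_triple_def)
  then show ?case
    by cases (use S D in \<open>auto simp: complies_def\<close>)
next
  case (r2a A B C)
  then show ?case by (auto dest: sat_sp_trans sat_bot_p_below)
next
  case (r2b D' E X Y)
  have "E \<notin> vocab"
    using r2b(1) vocab_free_union[OF S_triples D_triples] by (rule Cl_sp_object_not_vocab)
  then show ?case by (auto simp: vocab_def)
next
  case (r3a A B C)
  then show ?case by (auto dest: sat_sc_trans sat_bot_c_below)
next
  case (r5a A B)
  then show ?case by (auto dest: sat_bot_c_sym)
next
  case (r5b A B C)
  then show ?case by (auto dest: sat_bot_c_down sat_bot_c_below)
next
  case (r6a A B)
  then show ?case by (auto dest: sat_bot_p_sym)
next
  case (r6b A B C)
  then show ?case by (auto dest: sat_bot_p_down sat_bot_p_below)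
next
  case (r7a A C B D')
  then have A: "sat_triple I (A, Dom, C)" and B: "sat_triple I (B, Dom, D')" by auto
  \<comment> \<open>If the induction hypothesis only makes \<open>C\<close> or \<open>D'\<close>
    disjoint from itself, the disjointness of the two still follows, because both denote
    classes.\<close>
  then have "sat_triple I (C, Bot_c, D')"
    using r7a sat_dom_range_class sat_bot_c_class sat_bot_c_sym by (metis insertCI)
  with A B have "sat_triple I (A, Bot_p, B)"
    by (blast intro: sat_bot_p_intro)
  then show ?case by auto
next
  case (r7b A C B D')
  then have A: "sat_triple I (A, Rng, C)" and B: "sat_triple I (B, Rng, D')" by auto
  then have "sat_triple I (C, Bot_c, D')"
    using r7b sat_dom_range_class sat_bot_c_class sat_bot_c_sym by (metis insertCI)
  with A B have "sat_triple I (A, Bot_p, B)"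
    by (blast intro: sat_bot_p_intro)
  then show ?case by auto
\<comment> \<open>In 5c and 6c the premise makes \<open>A\<close> disjoint from itself, which is
  already one of the alternatives for the conclusion, whatever \<open>B\<close> denotes.\<close>
qed auto

section \<open>The term model\<close>

text \<open>Rules 5c and 6c relate arbitrary terms, while interpretations require disjointness to be
  a relation on classes or on properties; hence the extra restrictions on \<open>Bot_c\<close> and
  \<open>Bot_p\<close>.\<close>

definition term_model ::
  "('u, 'a, 'b) dgraph \<Rightarrow> ('u, 'a, 'b) triple set \<Rightarrow> ('u, 'a, 'b) interp" where
  "term_model G T =
     \<lparr> voc = vocab \<union> uni (strict_counterpart G), dR = DomR G, dP = DomP G, dC = DomC G,
       dL = DomL G,
       Pext = (\<lambda>p \<in> DomP G. {(x, y). (x, p, y) \<in> Cl T \<and> x \<in> DomR G \<and> y \<in> DomR G \<and>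
         (p = Bot_c \<longrightarrow> x \<in> DomC G \<and> y \<in> DomC G) \<and> (p = Bot_p \<longrightarrow> x \<in> DomP G \<and> y \<in> DomP G)}),
       Cext = (\<lambda>c \<in> DomC G. {x. (x, Typ, c) \<in> Cl T \<and> x \<in> DomR G}),
       den = (\<lambda>t \<in> vocab \<union> uni (strict_counterpart G). t) \<rparr>"

lemma vocab_subset_DomP: "vocab \<subseteq> DomP G"
  by (auto simp: DomP_def Let_def)

lemma DomP_subset_DomR: "DomP G \<subseteq> DomR G"
  by (auto simp: DomP_def DomR_def Let_def)

lemma DomC_subset_DomR: "DomC G \<subseteq> DomR G"
  by (auto simp: DomC_def DomR_def Let_def)

lemma vocab_not_literal: "vocab \<inter> literals = {}"
  by (auto simp: vocab_def literals_def)

lemma finite_uni: "finite T \<Longrightarrow> finite (uni T)"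
  by (auto simp: uni_def)

lemma finite_strict_counterpart:
  assumes "finite G" shows "finite (strict_counterpart G)"
proof -
  have "finite (Strict -` G)" "finite (Defeasible -` G)"
    using assms by (auto intro!: finite_vimageI injI)
  moreover have "strict_counterpart G = Strict -` G \<union> Defeasible -` G"
    by (auto simp: strict_counterpart_def strict_part_def strictify_def defeasible_part_def)
  ultimately show ?thesis by simp
qed

text \<open>The extensions are cut down to the domains of \<open>G\<close>, so \<open>T\<close> may
  be arbitrary here.\<close>

lemma term_model_interp:
  assumes "defeasible_graph G"
  shows "term_model G T \<in> interps G"
proof -
  have fin: "finite (DomR G)"
    using assms finite_uni[OF finite_strict_counterpart]
    by (auto simp: defeasible_graph_def DomR_def vocab_def)
  then have "finite (DomP G)" "finite (DomC G)"
    using DomP_subset_DomR DomC_subset_DomR by (metis finite_subset)+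
  moreover have L: "DomL G \<subseteq> DomR G" by (auto simp: DomL_def DomR_def)
  moreover have "finite (DomL G)" using fin L by (rule rev_finite_subset)
  ultimately show ?thesis
    using fin DomC_subset_DomR vocab_not_literal
    by (auto simp: interps_def is_interp_def term_model_def DomL_def DomR_def plain_literals_def
        literals_def)
qed

section \<open>Derived terms and the fixed domains\<close>

context
  fixes G :: "('u, 'a, 'b) dgraph" and T :: "('u, 'a, 'b) triple set"
  assumes T: "T \<subseteq> strict_counterpart G" and T_free: "vocab_free T"
begin

text \<open>The domains are read off the closure of \<open>strict_counterpart G\<close>; this
  inclusion makes them large enough for every such \<open>T\<close>.\<close>

lemma Cl_sub: "(x, p, y) \<in> Cl T \<Longrightarrow> (x, p, y) \<in> Cl (strict_counterpart G)"
  using Cl_mono[OF T] by blast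

lemma Cl_uni:
  assumes "(x, p, y) \<in> Cl T" and "p \<noteq> Bot_c" and "p \<noteq> Bot_p"
  shows "x \<in> uni (strict_counterpart G)" "y \<in> uni (strict_counterpart G)" "x \<notin> vocab" "y \<notin> vocab"
  using Cl_terms[OF assms(1) T_free assms(2,3)] T by (auto simp: uni_def)

text \<open>Away from the disjointness predicates the cut to \<open>DomR G\<close> removes nothing,
  by \<open>Cl_uni\<close>.\<close>

lemma Pext_term_model:
  assumes "p \<in> DomP G" and "p \<noteq> Bot_c" and "p \<noteq> Bot_p"
  shows "Pext (term_model G T) p = {(x, y). (x, p, y) \<in> Cl T}"
  using assms Cl_uni by (fastforce simp: term_model_def DomR_def)

lemma Pext_term_model_bot_c:
  "Pext (term_model G T) Bot_c = {(x, y). (x, Bot_c, y) \<in> Cl T \<and> x \<in> DomC G \<and> y \<in> DomC G}"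
  using subsetD[OF vocab_subset_DomP[of G], of Bot_c]
  by (auto simp: term_model_def intro: subsetD[OF DomC_subset_DomR])

lemma Pext_term_model_bot_p:
  "Pext (term_model G T) Bot_p = {(x, y). (x, Bot_p, y) \<in> Cl T \<and> x \<in> DomP G \<and> y \<in> DomP G}"
  using subsetD[OF vocab_subset_DomP[of G], of Bot_p]
  by (auto simp: term_model_def intro: subsetD[OF DomP_subset_DomR])

lemma Pext_term_model_vocab:
  "Pext (term_model G T) Sp = {(x, y). (x, Sp, y) \<in> Cl T}"
  "Pext (term_model G T) Sc = {(x, y). (x, Sc, y) \<in> Cl T}"
  "Pext (term_model G T) Typ = {(x, y). (x, Typ, y) \<in> Cl T}"
  "Pext (term_model G T) Dom = {(x, y). (x, Dom, y) \<in> Cl T}"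
  "Pext (term_model G T) Rng = {(x, y). (x, Rng, y) \<in> Cl T}"
  using vocab_subset_DomP[of G] by (auto simp: Pext_term_model subset_iff)

lemma term_model_fields:
  "voc (term_model G T) = vocab \<union> uni (strict_counterpart G)"
  "dP (term_model G T) = DomP G" "dC (term_model G T) = DomC G"
  "\<And>e. e \<in> vocab \<union> uni (strict_counterpart G) \<Longrightarrow> den (term_model G T) e = e"
  by (simp_all add: term_model_def)

lemma Cext_term_model:
  assumes "c \<in> DomC G"
  shows "Cext (term_model G T) c = {x. (x, Typ, c) \<in> Cl T}"
  using assms Cl_uni by (fastforce simp: term_model_def DomR_def)

lemma Cl_sp_DomP:
  assumes "(x, Sp, y) \<in> Cl T"
  shows "x \<in> DomP G" "y \<in> DomP G"
  using Cl_uni[OF assms] Cl_sub[OF assms] by (auto simp: DomP_def Let_def)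

lemma Cl_dom_range:
  assumes "(x, p, y) \<in> Cl T" and "p \<in> {Dom, Rng}"
  shows "x \<in> DomP G" "y \<in> DomC G"
  using Cl_uni[OF assms(1)] Cl_sub[OF assms(1)] assms(2) by (auto simp: DomP_def DomC_def Let_def)

lemma Cl_sc_DomC:
  assumes "(x, Sc, y) \<in> Cl T"
  shows "x \<in> DomC G" "y \<in> DomC G"
  using Cl_uni[OF assms] Cl_sub[OF assms] by (auto simp: DomC_def Let_def)

lemma Cl_typ_DomC:
  assumes "(x, Typ, y) \<in> Cl T"
  shows "y \<in> DomC G"
  using Cl_uni[OF assms] Cl_sub[OF assms] by (auto simp: DomC_def Let_def)

lemmas term_model_simps =
  term_model_fields Pext_term_model_vocab Pext_term_model_bot_c Pext_term_model_bot_p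

section \<open>Semantic conditions in the term model\<close>

lemma term_model_subproperty: "sat_subproperty (term_model G T)"
proof -
  have "Pext (term_model G T) x \<subseteq> Pext (term_model G T) y" if "(x, Sp, y) \<in> Cl T" for x y
  proof -
    \<comment> \<open>Neither extension is one of the two specially restricted ones, so rule 2b
      yields the inclusion.\<close>
    have "x \<notin> vocab" "y \<notin> vocab" using Cl_uni[OF that] by auto
    then have "x \<noteq> Bot_c" "x \<noteq> Bot_p" "y \<noteq> Bot_c" "y \<noteq> Bot_p" by auto
    with Cl_sp_DomP[OF that] show ?thesis
      using that by (auto simp: Pext_term_model intro: Cl.r2b)
  qed
  then show ?thesis
    by (auto simp: sat_subproperty_def term_model_simps Cl_sp_DomP
        intro!: trans_onI intro: Cl.r2a)
qed

lemma term_model_subclass: "sat_subclass (term_model G T)"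
  by (auto simp: sat_subclass_def term_model_simps Cl_sc_DomC Cext_term_model
      intro!: trans_onI intro: Cl.r3a Cl.r3b)

lemma term_model_typing: "sat_typing (term_model G T)"
proof -
  have "(x, Typ, c) \<in> Cl T"
    if "(p, Dom, c) \<in> Cl T" "(x, y) \<in> Pext (term_model G T) p" for x y p c
  proof -
    have "p \<notin> vocab" using Cl_uni[OF that(1)] by auto
    then have "p \<noteq> Bot_c" "p \<noteq> Bot_p" by auto
    then show ?thesis
      using that Cl_dom_range[OF that(1)] by (auto simp: Pext_term_model intro: Cl.r4a)
  qed
  moreover have "(y, Typ, c) \<in> Cl T"
    if "(p, Rng, c) \<in> Cl T" "(x, y) \<in> Pext (term_model G T) p" for x y p c
  proof -
    have "p \<notin> vocab" using Cl_uni[OF that(1)] by auto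
    then have "p \<noteq> Bot_c" "p \<noteq> Bot_p" by auto
    then show ?thesis
      using that Cl_dom_range[OF that(1)] by (auto simp: Pext_term_model intro: Cl.r4b)
  qed
  ultimately show ?thesis
    using Cl_dom_range
    by (auto simp: sat_typing_def term_model_simps Cext_term_model Cl_typ_DomC)
qed

lemma term_model_disjointness: "sat_disjointness (term_model G T)"
proof -
  have Pden:
    "Pden (term_model G T) Sp = {(x, y). (x, Sp, y) \<in> Cl T}"
    "Pden (term_model G T) Sc = {(x, y). (x, Sc, y) \<in> Cl T}"
    "Pden (term_model G T) Dom = {(x, y). (x, Dom, y) \<in> Cl T}"
    "Pden (term_model G T) Rng = {(x, y). (x, Rng, y) \<in> Cl T}"
    "Pden (term_model G T) Bot_c = {(x, y). (x, Bot_c, y) \<in> Cl T \<and> x \<in> DomC G \<and> y \<in> DomC G}"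
    "Pden (term_model G T) Bot_p = {(x, y). (x, Bot_p, y) \<in> Cl T \<and> x \<in> DomP G \<and> y \<in> DomP G}"
    by (simp_all add: term_model_simps)
  show ?thesis
    unfolding sat_disjointness_def Pden term_model_fields(2,3) mem_Collect_eq prod.case
  proof (intro conjI allI impI symI)
    show "(e, Bot_c, d) \<in> Cl T" "e \<in> DomC G" "d \<in> DomC G"
      if "(c, Bot_c, d) \<in> Cl T \<and> c \<in> DomC G \<and> d \<in> DomC G" "(e, Sc, c) \<in> Cl T" for c d e
      using that Cl.r5b[of c d T e] Cl_sc_DomC[of e c] by simp_all
  next
    show "(e, Bot_p, q) \<in> Cl T" "e \<in> DomP G" "q \<in> DomP G"
      if "(p, Bot_p, q) \<in> Cl T \<and> p \<in> DomP G \<and> q \<in> DomP G" "(e, Sp, p) \<in> Cl T" for p q e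
      using that Cl.r6b[of p q T e] Cl_sp_DomP[of e p] by simp_all
  next
    show "(p, Bot_p, q) \<in> Cl T" "p \<in> DomP G" "q \<in> DomP G"
      if "(p, Dom, c) \<in> Cl T" "(q, Dom, d) \<in> Cl T"
        "(c, Bot_c, d) \<in> Cl T \<and> c \<in> DomC G \<and> d \<in> DomC G" for p q c d
      using that Cl.r7a[of p c T q d] Cl_dom_range(1)[of p Dom c] Cl_dom_range(1)[of q Dom d]
      by simp_all
  next
    show "(p, Bot_p, q) \<in> Cl T" "p \<in> DomP G" "q \<in> DomP G"
      if "(p, Rng, c) \<in> Cl T" "(q, Rng, d) \<in> Cl T"
        "(c, Bot_c, d) \<in> Cl T \<and> c \<in> DomC G \<and> d \<in> DomC G" for p q c d
      using that Cl.r7b[of p c T q d] Cl_dom_range(1)[of p Rng c] Cl_dom_range(1)[of q Rng d]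
      by simp_all
  qed (auto intro: Cl.r5a Cl.r5c Cl.r6a Cl.r6c)
qed

lemma term_model_sat: "sat (term_model G T) T"
proof -
  have "den (term_model G T) p \<in> DomP G \<and>
      (den (term_model G T) s, den (term_model G T) ob) \<in> Pden (term_model G T) p"
    if t: "(s, p, ob) \<in> T" for s p ob
  proof -
    have Cl: "(s, p, ob) \<in> Cl T" using t by (rule Cl.base)
    have mem: "s \<in> uni (strict_counterpart G)" "p \<in> uni (strict_counterpart G)"
      "ob \<in> uni (strict_counterpart G)"
      using t T by (fastforce simp: uni_def)+
    then have p: "p \<in> DomP G"
      using Cl_sub[OF Cl] by (auto simp: DomP_def Let_def)
    \<comment> \<open>If \<open>p\<close> is \<open>Bot_c\<close> or \<open>Bot_p\<close>, the
      triple itself puts \<open>s\<close> and \<open>ob\<close> into \<open>DomC G\<close> or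
      \<open>DomP G\<close>.\<close>
    moreover have "(s, ob) \<in> Pext (term_model G T) p"
      using p Cl Cl_sub[OF Cl] mem
      by (auto simp: term_model_def DomR_def DomC_def DomP_def Let_def)
    ultimately show ?thesis using mem by (simp add: term_model_fields)
  qed
  then have "sat_simple (term_model G T) T"
    using vocab_subset_DomP[of G] by (auto simp: sat_simple_def term_model_fields)
  moreover have "uni T \<subseteq> uni (strict_counterpart G)"
    using T by (auto simp: uni_def)
  ultimately show ?thesis
    by (auto simp: sat_def term_model_fields term_model_subproperty term_model_subclass
        term_model_typing term_model_disjointness)
qed

text \<open>Confined to \<open>T\<close>, since rules 5c and 6c can derive triples about terms that
  the model does not interpret.\<close>

lemma term_model_sound:
  assumes "t \<in> T" shows "sat_triple (term_model G T) t"
  using term_model_sat by (rule sat_mono) (use assms in simp)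

text \<open>Interpreted terms denote themselves and every extension is cut out of
  \<open>Cl T\<close>. This makes term models counterexamples to underivable triples.\<close>

lemma term_model_complete:
  assumes "sat_triple (term_model G T) (s, p, ob)"
  shows "(s, p, ob) \<in> Cl T"
  using assms by (auto simp: sat_triple_iff term_model_def restrict_def split: if_splits)

end

section \<open>The minimal ranked model\<close>

abbreviation level :: "('u, 'a, 'b) dgraph \<Rightarrow> nat \<Rightarrow> ('u, 'a, 'b) triple set" where
  "level G i \<equiv> strict_part G \<union> strictify (D_seq G i)"

definition level_model :: "('u, 'a, 'b) dgraph \<Rightarrow> nat \<Rightarrow> ('u, 'a, 'b) interp \<Rightarrow> bool" where
  "level_model G i I \<longleftrightarrow> (\<forall>t \<in> strict_part G. sat_triple I t) \<and> complies I (D_seq G i)"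

text \<open>For finite \<open>G\<close>, rank \<infinity> is left to interpretations that violate
  the strict part or fail to comply with a default lying in every \<open>D_seq G i\<close>.\<close>

definition min_ranking :: "('u, 'a, 'b) dgraph \<Rightarrow> ('u, 'a, 'b) ranking" where
  "min_ranking G =
     (\<lambda>I \<in> interps G. if \<exists>i. level_model G i I then enat (LEAST i. level_model G i I) else \<infinity>)"

declare D_seq.simps(2) [simp del]

lemma D_seq_antimono: "i \<le> j \<Longrightarrow> D_seq G j \<subseteq> D_seq G i"
  by (rule lift_Suc_antimono_le[of "D_seq G"]) (auto simp: D_seq.simps(2))

lemma level_model_mono: "level_model G i I \<Longrightarrow> i \<le> j \<Longrightarrow> level_model G j I"
  using D_seq_antimono complies_mono unfolding level_model_def by metis

text \<open>The sets \<open>D_seq G i\<close> shrink, so the indices with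
  \<open>level_model G i I\<close> are closed upwards and the least one is a threshold.\<close>

lemma min_ranking_le_iff:
  assumes "I \<in> interps G"
  shows "min_ranking G I \<le> enat i \<longleftrightarrow> level_model G i I"
proof
  assume "min_ranking G I \<le> enat i"
  then show "level_model G i I"
    using assms level_model_mono
    by (auto simp: min_ranking_def split: if_splits intro: LeastI level_model_mono)
next
  assume "level_model G i I"
  then show "min_ranking G I \<le> enat i"
    using assms by (auto simp: min_ranking_def intro: Least_le)
qed

lemma ranked_sat_Defeasible:
  assumes "p \<in> {Sc, Sp}"
  shows "ranked_sat G r (Defeasible (s, p, ob)) \<longleftrightarrow>
    (\<forall>I \<in> finite_rank G r. \<not> sat_triple I (s, disj_pred p, s) \<longrightarrow>
      (\<forall>J \<in> finite_rank G r. \<not> sat_triple J (s, disj_pred p, s) \<longrightarrow> r I \<le> r J) \<longrightarrow>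
      sat_triple I (s, p, ob))"
  using assms by (auto simp: ranked_sat_def cmin_def pmin_def)

context
  fixes G :: "('u, 'a, 'b) dgraph"
  assumes G: "defeasible_graph G"
begin

section \<open>Soundness and completeness at a level\<close>

lemma strict_part_triples: "\<forall>t \<in> strict_part G. is_triple t"
  using G by (auto simp: defeasible_graph_def strict_part_def)

lemma D_seq_subset: "D_seq G i \<subseteq> defeasible_part G"
  using D_seq_antimono[of 0 i G] by simp

lemma default_set_D_seq: "default_set (D_seq G i)"
  using G D_seq_subset[of i]
  by (auto simp: default_set_def defeasible_graph_def defeasible_part_def)

lemma default_predicate: "Defeasible (s, p, ob) \<in> D_seq G i \<Longrightarrow> p \<in> {Sc, Sp}"
  using default_set_D_seq by (auto simp: default_set_def is_defeasible_triple_def)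

lemma D_seq_Suc_iff:
  "Defeasible (s, p, ob) \<in> D_seq G (Suc i) \<longleftrightarrow>
     Defeasible (s, p, ob) \<in> D_seq G i \<and> (s, disj_pred p, s) \<in> Cl (level G i)"
  using default_predicate[of s p ob i] by (auto simp: D_seq.simps(2))

lemma level_free: "vocab_free (level G i)"
  using strict_part_triples default_set_D_seq by (rule vocab_free_union)

lemma level_sub: "level G i \<subseteq> strict_counterpart G"
  using D_seq_subset[of i] by (auto simp: strict_counterpart_def strictify_def)

text \<open>For a triple relating a term to itself the three alternatives of
  \<open>complies_sound\<close> coincide, so exceptionality transfers without reservation.\<close>

lemma level_model_bot:
  assumes "level_model G i I" and "(s, b, s) \<in> Cl (level G i)" and "b \<in> {Bot_c, Bot_p}"
  shows "sat_triple I (s, b, s)"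
  using complies_sound[OF assms(2) _ _ strict_part_triples default_set_D_seq] assms
  by (auto simp: level_model_def)

lemma level_model_sc:
  assumes "level_model G i I" and "(s, Sc, ob) \<in> Cl (level G i)"
  shows "sat_triple I (s, Bot_c, s) \<or> sat_triple I (s, Sc, ob)"
  using complies_sound[OF assms(2) _ _ strict_part_triples default_set_D_seq] assms
  by (auto simp: level_model_def)

lemmas level_term_model_complete = term_model_complete[OF level_sub level_free]

lemma level_term_model: "level_model G i (term_model G (level G i))"
  using term_model_sound[OF level_sub level_free]
  by (auto simp: level_model_def complies_def strictify_def)

lemma min_ranking_term_model: "min_ranking G (term_model G (level G i)) \<le> enat i"
  using term_model_interp[OF G] level_term_model by (simp add: min_ranking_le_iff)

lemma term_model_finite_rank: "term_model G (level G i) \<in> finite_rank G (min_ranking G)"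
  using term_model_interp[OF G] min_ranking_term_model[of i]
  by (cases "min_ranking G (term_model G (level G i))") (auto simp: finite_rank_def)

text \<open>Exceptionality at level \<open>i\<close> passes to this term model by soundness and back
  to derivability at level \<open>Suc i\<close> by completeness, so no further default drops out.
  This rules out gaps in the ranking.\<close>

lemma D_seq_stable_if_collapse:
  assumes "level_model G i (term_model G (level G (Suc i)))"
  shows "D_seq G (Suc (Suc i)) = D_seq G (Suc i)"
proof
  show "D_seq G (Suc (Suc i)) \<subseteq> D_seq G (Suc i)"
    by (rule D_seq_antimono) simp
  show "D_seq G (Suc i) \<subseteq> D_seq G (Suc (Suc i))"
  proof
    fix \<tau> assume \<tau>: "\<tau> \<in> D_seq G (Suc i)"
    then obtain s p ob where eq: "\<tau> = Defeasible (s, p, ob)"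
      using D_seq_subset[of "Suc i"] by (auto simp: defeasible_part_def)
    then have "(s, disj_pred p, s) \<in> Cl (level G i)"
      using \<tau> unfolding eq D_seq_Suc_iff by blast
    then have "(s, disj_pred p, s) \<in> Cl (level G (Suc i))"
      using level_model_bot[OF assms] level_term_model_complete by (auto simp: disj_pred_def)
    with \<tau> show "\<tau> \<in> D_seq G (Suc (Suc i))"
      unfolding eq D_seq_Suc_iff[of _ _ _ "Suc i"] by blast
  qed
qed

lemma min_ranking_ranked_interp: "ranked_interp G (min_ranking G)"
proof -
  have attained: "enat i \<in> min_ranking G ` interps G"
    if I: "I \<in> interps G" and rank: "min_ranking G I = enat (Suc i)" for I i
  proof -
    let ?M = "term_model G (level G i)"
    have "min_ranking G ?M = enat i"
    proof (rule antisym[OF min_ranking_term_model], rule ccontr)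
      assume "\<not> enat i \<le> min_ranking G ?M"
      \<comment> \<open>A rank of \<open>?M\<close> below \<open>i\<close> means collapse at the
        predecessor \<open>k\<close>; then levels \<open>i\<close> and \<open>Suc i\<close> agree
        and \<open>I\<close> could not have rank \<open>Suc i\<close>.\<close>
      then obtain k where k: "i = Suc k" "min_ranking G ?M \<le> enat k"
        by (cases "min_ranking G ?M"; cases i) auto
      then have "D_seq G (Suc i) = D_seq G i"
        using D_seq_stable_if_collapse min_ranking_le_iff[OF term_model_interp[OF G]] by blast
      moreover have "level_model G (Suc i) I"
        using min_ranking_le_iff[OF I, of "Suc i"] rank by simp
      ultimately have "level_model G i I" by (simp add: level_model_def)
      with rank show False
        using min_ranking_le_iff[OF I, of i] by simp
    qed
    then show ?thesis using term_model_interp[OF G] by (metis imageI)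
  qed
  have "min_ranking G (term_model G (level G 0)) = 0"
    using min_ranking_term_model[of 0] by (simp add: zero_enat_def[symmetric])
  then have "0 \<in> min_ranking G ` interps G"
    using term_model_interp[OF G] by (metis imageI)
  moreover have "enat (i - 1) \<in> min_ranking G ` interps G"
    if "i > 0" "enat i \<in> min_ranking G ` interps G" for i
  proof -
    from that(2) obtain I where "I \<in> interps G" "min_ranking G I = enat i" by auto
    then show ?thesis using that(1) attained[of I "i - 1"] by simp
  qed
  ultimately show ?thesis
    by (auto simp: ranked_interp_def min_ranking_def)
qed

lemma min_ranking_model: "ranked_model G (min_ranking G)"
  unfolding ranked_model_def
proof (intro conjI ballI min_ranking_ranked_interp)
  fix \<tau> assume \<tau>: "\<tau> \<in> G"
  have level: "\<exists>k. min_ranking G I = enat k \<and> level_model G k I"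
    if "I \<in> finite_rank G (min_ranking G)" for I
    using that min_ranking_le_iff[of I G, symmetric] by (auto simp: finite_rank_def)
  show "ranked_sat G (min_ranking G) \<tau>"
  proof (cases \<tau>)
    case (Strict t)
    with \<tau> have "t \<in> strict_part G" by (simp add: strict_part_def)
    then have "sat_triple I t" if "I \<in> finite_rank G (min_ranking G)" for I
      using level[OF that] unfolding level_model_def by blast
    then show ?thesis by (simp add: Strict ranked_sat_def)
  next
    case (Defeasible t)
    obtain s p ob where t: "t = (s, p, ob)" by (cases t)
    have d0: "Defeasible (s, p, ob) \<in> D_seq G 0"
      using \<tau> by (simp add: Defeasible t defeasible_part_def)
    have "sat_triple I (s, p, ob)"
      if I: "I \<in> finite_rank G (min_ranking G)" and nb: "\<not> sat_triple I (s, disj_pred p, s)"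
        and min: "\<forall>J \<in> finite_rank G (min_ranking G).
          \<not> sat_triple J (s, disj_pred p, s) \<longrightarrow> min_ranking G I \<le> min_ranking G J" for I
    proof -
      from level[OF I] obtain k where k: "min_ranking G I = enat k" "level_model G k I" by blast
      \<comment> \<open>If the default dropped out after some level \<open>i < k\<close>, the term
        model of that level would not make \<open>s\<close> exceptional and would have rank at most
        \<open>i\<close>, against the minimality of \<open>I\<close>.\<close>
      have "Defeasible (s, p, ob) \<in> D_seq G i" if "i \<le> k" for i
        using that
      proof (induction i)
        case 0
        show ?case by (rule d0)
      next
        case (Suc i)
        have "(s, disj_pred p, s) \<in> Cl (level G i)"
        proof (rule ccontr)
          assume "(s, disj_pred p, s) \<notin> Cl (level G i)"
          then have "enat k \<le> min_ranking G (term_model G (level G i))"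
            using min term_model_finite_rank level_term_model_complete k(1) by metis
          also have "\<dots> \<le> enat i" by (rule min_ranking_term_model)
          finally show False using Suc.prems by simp
        qed
        with Suc show ?case unfolding D_seq_Suc_iff by simp
      qed
      then show ?thesis
        using k(2) nb unfolding level_model_def complies_def by blast
    qed
    then show ?thesis
      using ranked_sat_Defeasible[OF default_predicate[OF d0]] by (simp add: Defeasible t)
  qed
qed

text \<open>Strong induction on the rank. For a default in \<open>D_seq G i\<close>, every
  \<open>J\<close> of smaller finite rank \<open>k\<close> is a level model of \<open>k\<close> and
  thus makes the subject exceptional. If \<open>I\<close> does not, it is minimal for that subject
  and must satisfy the default.\<close>

lemma ranked_model_level:
  assumes r: "ranked_model G r" and "I \<in> interps G" and "r I = enat i"
  shows "level_model G i I"
  using assms(2,3)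
proof (induction i arbitrary: I rule: less_induct)
  case (less i)
  have fin: "I \<in> finite_rank G r" using less.prems by (simp add: finite_rank_def)
  have "sat_triple I t" if "t \<in> strict_part G" for t
  proof -
    have "ranked_sat G r (Strict t)"
      using r that by (simp add: ranked_model_def strict_part_def)
    with fin show ?thesis by (simp add: ranked_sat_def)
  qed
  moreover have "sat_triple I (s, p, ob)"
    if d: "Defeasible (s, p, ob) \<in> D_seq G i" and nb: "\<not> sat_triple I (s, disj_pred p, s)" for s p ob
  proof -
    have "Defeasible (s, p, ob) \<in> G"
      using d D_seq_subset[of i] by (auto simp: defeasible_part_def)
    then have sat: "ranked_sat G r (Defeasible (s, p, ob))"
      using r by (simp add: ranked_model_def)
    have "r I \<le> r J" if J: "J \<in> finite_rank G r" and nbJ: "\<not> sat_triple J (s, disj_pred p, s)" for J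
    proof (rule ccontr)
      assume "\<not> r I \<le> r J"
      then obtain k where k: "r J = enat k" "k < i"
        using less.prems by (cases "r J") auto
      then have "level_model G k J"
        using less.IH J by (simp add: finite_rank_def)
      moreover have "Defeasible (s, p, ob) \<in> D_seq G (Suc k)"
        using d k(2) D_seq_antimono[of "Suc k" i G] by auto
      then have "(s, disj_pred p, s) \<in> Cl (level G k)"
        unfolding D_seq_Suc_iff by blast
      ultimately have "sat_triple J (s, disj_pred p, s)"
        by (rule level_model_bot) (simp add: disj_pred_def)
      with nbJ show False ..
    qed
    with sat show ?thesis
      using ranked_sat_Defeasible[OF default_predicate[OF d]] fin nb by blast
  qed
  ultimately show ?case unfolding level_model_def complies_def by blast
qed

lemma min_ranking_least:
  assumes "ranked_model G r"
  shows "rank_le G (min_ranking G) r"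
  unfolding rank_le_def
proof
  fix I assume I: "I \<in> interps G"
  then show "min_ranking G I \<le> r I"
    using ranked_model_level[OF assms I] by (cases "r I") (auto simp: min_ranking_le_iff)
qed

text \<open>A least ranked model is the only minimal one; rankings are extensional, so agreement on
  \<open>interps G\<close> is equality.\<close>

lemma R_min_eq: "R_min G = min_ranking G"
  unfolding R_min_def
proof (rule the_equality)
  have "r = min_ranking G" if r: "ranked_model G r" and le: "rank_le G r (min_ranking G)" for r
  proof (rule PiE_ext)
    show "r \<in> interps G \<rightarrow>\<^sub>E UNIV" "min_ranking G \<in> interps G \<rightarrow>\<^sub>E UNIV"
      using r min_ranking_model by (simp_all add: ranked_model_def ranked_interp_def)
    show "r I = min_ranking G I" if "I \<in> interps G" for I
      using le min_ranking_least[OF r] that by (auto simp: rank_le_def intro: antisym)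
  qed
  then show "minimal_ranked_model G (min_ranking G)"
    by (simp add: minimal_ranked_model_def min_ranking_model)
  show "r = min_ranking G" if "minimal_ranked_model G r" for r
    using that min_ranking_model min_ranking_least unfolding minimal_ranked_model_def by metis
qed

section \<open>The decision procedure\<close>

lemma D_seq_stabilises: "\<exists>n. D_seq G n = D_seq G (Suc n)"
proof (rule ccontr)
  assume neq: "\<not> ?thesis"
  have fin: "finite (D_seq G n)" for n
    using D_seq_subset[of n] G
    by (auto simp: defeasible_graph_def defeasible_part_def intro: finite_subset)
  have "D_seq G (Suc n) \<subset> D_seq G n" for n
    using neq D_seq_antimono[of n "Suc n" G] by auto
  then have dec: "card (D_seq G (Suc n)) < card (D_seq G n)" for n
    using psubset_card_mono[OF fin] by blast
  have "card (D_seq G n) + n \<le> card (D_seq G 0)" for n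
  proof (induction n)
    case (Suc n)
    then show ?case using dec[of n] by linarith
  qed simp
  from this[of "Suc (card (D_seq G 0))"] show False by simp
qed

text \<open>Only the base case, 2b and 3a can conclude an \<open>Sc\<close>-triple, and 2b is
  excluded because \<open>Sc\<close> is reserved. So property defaults do not enter, and a chain
  through an exceptional class has an exceptional start.\<close>

lemma Cl_drop_exceptional:
  assumes "(s, Sc, ob) \<in> Cl (level G j)"
    and Dp: "Dp = {Defeasible (a, Sc, b) | a b. Defeasible (a, Sc, b) \<in> D_seq G j - D_seq G (Suc j)}"
  shows "(s, Bot_c, s) \<in> Cl (level G j) \<or> (s, Sc, ob) \<in> Cl (strict_part G \<union> strictify Dp)"
  using assms(1)
proof (induction "(s, Sc :: ('u, 'a, 'b) rdf_term, ob)" arbitrary: s ob rule: Cl.induct)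
  case (base s ob)
  then consider "(s, Sc, ob) \<in> strict_part G" | "Defeasible (s, Sc, ob) \<in> Dp"
    | "Defeasible (s, Sc, ob) \<in> D_seq G (Suc j)"
    by (auto simp: Dp strictify_def)
  then show ?case
  proof cases
    case 3
    then show ?thesis unfolding D_seq_Suc_iff by simp
  qed (auto simp: strictify_def intro: Cl.base)
next
  case (r2b D X Y)
  then show ?case using Cl_sp_object_not_vocab[OF _ level_free] by force
next
  case (r3a A B C)
  then show ?case by (blast intro: Cl.r3a Cl_bot_c_below)
qed

text \<open>Trades the finite list for the whole sequence, by stabilisation, and the selected
  defaults for the full level, by \<open>Cl_drop_exceptional\<close>.\<close>

lemma DefMinEntailmentC_Ranking:
  "DefMinEntailmentC G (Ranking G) p q \<longleftrightarrow>
     (\<forall>i. (p, Bot_c, p) \<in> Cl (level G i)) \<or>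
     (\<exists>j. (\<forall>i<j. (p, Bot_c, p) \<in> Cl (level G i)) \<and> (p, Bot_c, p) \<notin> Cl (level G j) \<and>
        (p, Sc, q) \<in> Cl (level G j))"
proof -
  define n where "n = (LEAST n. D_seq G n = D_seq G (Suc n))"
  have n: "D_seq G n = D_seq G (Suc n)"
    unfolding n_def using D_seq_stabilises by (rule LeastI_ex)
  have stable: "D_seq G (n + k) = D_seq G n" for k
  proof (induction k)
    case (Suc k)
    then have "D_seq G (Suc (n + k)) = D_seq G (Suc n)" by (simp only: D_seq.simps(2))
    then show ?case using n by simp
  qed simp
  have len: "length (Ranking G) - 2 = n"
    by (simp add: Ranking_def Let_def flip: n_def)
  \<comment> \<open>The last entry, at index \<open>n + 1\<close>, is \<open>D_seq G n\<close>,
    which equals \<open>D_seq G (Suc n)\<close>; hence list and sequence also agree there, as needed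
    for \<open>j + 1\<close> when \<open>j = n\<close>.\<close>
  have nth: "Ranking G ! i = D_seq G i" if "i \<le> n + 1" for i
    using that n by (cases "i = n + 1") (auto simp: Ranking_def Let_def nth_append simp flip: n_def
        simp del: upt_Suc)
  let ?E = "\<lambda>i. (p, Bot_c, p) \<in> Cl (level G i)"
  let ?E' = "\<lambda>i. (p, Bot_c, p) \<in> Cl (strict_part G \<union> strictify (Ranking G ! i))"
  have E': "?E' i = ?E i" if "i \<le> n" for i
    using nth[of i] that by simp
  have bound: "(\<forall>i\<le>n. ?E i) \<longleftrightarrow> (\<forall>i. ?E i)"
    using stable by (metis le_refl le_iff_add nat_le_linear)
  show ?thesis
  proof (cases "\<forall>i. ?E i")
    case True
    then show ?thesis
      using E' by (simp add: DefMinEntailmentC_def Let_def len)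
  next
    case False
    define j where "j = (LEAST j. j \<le> n \<and> \<not> ?E' j)"
    have not_exc: "\<not> (\<forall>i\<le>n. ?E' i)" using False bound E' by blast
    then have "\<exists>j. j \<le> n \<and> \<not> ?E' j" by blast
    then have j: "j \<le> n" "\<not> ?E j"
      using LeastI_ex[of "\<lambda>j. j \<le> n \<and> \<not> ?E' j"] E' by (auto simp: j_def)
    have below: "?E i" if "i < j" for i
      using not_less_Least[of i "\<lambda>j. j \<le> n \<and> \<not> ?E' j"] that j(1) E'[of i] by (simp add: j_def)
    define Dp where "Dp = {Defeasible (a, Sc, b) | a b.
      Defeasible (a, Sc, b) \<in> D_seq G j - D_seq G (Suc j)}"
    have "DefMinEntailmentC G (Ranking G) p q \<longleftrightarrow> (p, Sc, q) \<in> Cl (strict_part G \<union> strictify Dp)"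
      unfolding DefMinEntailmentC_def Let_def len if_not_P[OF not_exc] j_def[symmetric]
      using nth[of j] nth[of "Suc j"] j(1) by (simp add: Dp_def)
    also have "\<dots> \<longleftrightarrow> (p, Sc, q) \<in> Cl (level G j)"
    proof
      have "strict_part G \<union> strictify Dp \<subseteq> level G j"
        by (auto simp: strictify_def Dp_def)
      then show "(p, Sc, q) \<in> Cl (level G j)" if "(p, Sc, q) \<in> Cl (strict_part G \<union> strictify Dp)"
        using that Cl_mono by blast
      show "(p, Sc, q) \<in> Cl (strict_part G \<union> strictify Dp)" if "(p, Sc, q) \<in> Cl (level G j)"
        using Cl_drop_exceptional[OF that Dp_def] j(2) by blast
    qed
    also have "\<dots> \<longleftrightarrow> (\<exists>j. (\<forall>i<j. ?E i) \<and> \<not> ?E j \<and> (p, Sc, q) \<in> Cl (level G j))"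
      using j(2) below by (metis linorder_neqE_nat)
    finally show ?thesis using False by blast
  qed
qed

text \<open>Every interpretation of finite rank is a model of some level and so makes
  \<open>p\<close> exceptional; the default holds vacuously.\<close>

lemma min_entails_if_exceptional:
  assumes "\<forall>i. (p, Bot_c, p) \<in> Cl (level G i)"
  shows "G \<Turnstile>\<^sub>m\<^sub>i\<^sub>n Defeasible (p, Sc, q)"
proof -
  have "sat_triple I (p, Bot_c, p)" if I: "I \<in> finite_rank G (min_ranking G)" for I
  proof -
    obtain k where "min_ranking G I \<le> enat k" and "I \<in> interps G"
      using I by (cases "min_ranking G I") (auto simp: finite_rank_def)
    then have "level_model G k I" using min_ranking_le_iff by blast
    then show ?thesis using assms by (intro level_model_bot) simp_all
  qed
  then have "cmin p G (min_ranking G) = {}" unfolding cmin_def by blast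
  then show ?thesis
    by (simp add: min_entails_def R_min_eq ranked_sat_def)
qed

lemma min_entails_iff_level:
  assumes below: "\<forall>i<j. (p, Bot_c, p) \<in> Cl (level G i)" and j: "(p, Bot_c, p) \<notin> Cl (level G j)"
  shows "G \<Turnstile>\<^sub>m\<^sub>i\<^sub>n Defeasible (p, Sc, q) \<longleftrightarrow> (p, Sc, q) \<in> Cl (level G j)"
proof -
  let ?M = "term_model G (level G j)"
  have M: "\<not> sat_triple ?M (p, Bot_c, p)"
    using j level_term_model_complete by blast
  have ge: "enat j \<le> min_ranking G I"
    if "I \<in> interps G" "\<not> sat_triple I (p, Bot_c, p)" for I
  proof (rule ccontr)
    assume "\<not> enat j \<le> min_ranking G I"
    then obtain k where "k < j" "min_ranking G I \<le> enat k"
      by (cases "min_ranking G I") (auto simp: not_le)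
    then show False
      using below level_model_bot[of k I p Bot_c] min_ranking_le_iff[OF that(1)] that(2) by auto
  qed
  have cmin: "cmin p G (min_ranking G) =
      {I \<in> interps G. level_model G j I \<and> \<not> sat_triple I (p, Bot_c, p)}" (is "_ = ?R")
  proof (intro equalityI subsetI)
    fix I assume I: "I \<in> cmin p G (min_ranking G)"
    then have "min_ranking G I \<le> min_ranking G ?M"
      using M term_model_finite_rank by (simp add: cmin_def)
    then have "min_ranking G I \<le> enat j"
      using min_ranking_term_model order_trans by blast
    with I show "I \<in> ?R"
      by (auto simp: cmin_def finite_rank_def min_ranking_le_iff)
  next
    fix I assume I: "I \<in> ?R"
    then have le: "min_ranking G I \<le> enat j" by (simp add: min_ranking_le_iff)
    then have "min_ranking G I < \<infinity>"
      by (cases "min_ranking G I") auto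
    with I le show "I \<in> cmin p G (min_ranking G)"
      using ge by (auto simp: cmin_def finite_rank_def intro: order_trans)
  qed
  have "?M \<in> cmin p G (min_ranking G)"
    using M level_term_model term_model_interp[OF G] by (simp add: cmin)
  \<comment> \<open>The term model refutes an underivable triple; conversely, members of
    \<open>cmin\<close> exclude the exceptional alternative of
    \<open>level_model_sc\<close>.\<close>
  then have "(\<forall>I \<in> cmin p G (min_ranking G). sat_triple I (p, Sc, q)) \<longleftrightarrow>
      (p, Sc, q) \<in> Cl (level G j)"
    using level_term_model_complete level_model_sc unfolding cmin by blast
  then show ?thesis
    by (simp add: min_entails_def R_min_eq ranked_sat_def)
qed

end

theorem theorem3p25:
  fixes G :: "('u, 'a, 'b) dgraph"
    and p q :: "('u, 'a, 'b) rdf_term"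
  assumes "defeasible_graph G"
    and "is_defeasible_triple (p, Sc, q)"
  shows "G \<Turnstile>\<^sub>m\<^sub>i\<^sub>n Defeasible (p, Sc, q) \<longleftrightarrow> DefMinEntailmentC G (Ranking G) p q"
proof (cases "\<forall>i. (p, Bot_c, p) \<in> Cl (level G i)")
  case True
  then show ?thesis
    using min_entails_if_exceptional[OF assms(1)] DefMinEntailmentC_Ranking[OF assms(1)] by blast
next
  case False
  then obtain j where j: "(p, Bot_c, p) \<notin> Cl (level G j)"
    "\<forall>i<j. (p, Bot_c, p) \<in> Cl (level G i)"
    using exists_least_iff[of "\<lambda>i. (p, Bot_c, p) \<notin> Cl (level G i)"] by blast
  \<comment> \<open>The level whose existence \<open>DefMinEntailmentC_Ranking\<close> speaks of is
    unique, so it is the \<open>j\<close> chosen here.\<close>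
  have "i = j" if "\<forall>k<i. (p, Bot_c, p) \<in> Cl (level G k)" "(p, Bot_c, p) \<notin> Cl (level G i)" for i
    using that j by (cases i j rule: linorder_cases) blast+
  with j have "DefMinEntailmentC G (Ranking G) p q \<longleftrightarrow> (p, Sc, q) \<in> Cl (level G j)"
    unfolding DefMinEntailmentC_Ranking[OF assms(1)] by blast
  then show ?thesis
    using min_entails_iff_level[OF assms(1) j(2,1)] by simp
qed

end
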